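(* Let $k,n\ge 1$ be integers and write $n=qk+r$ with $0\le r<k$. Then $$\mathrm{ex}(n,\overrightarrow{C_{k+1}})=a(\overrightarrow{F_{n,k}})=\frac{1}{2}n^2+\frac{k-2}{2}n-\frac{r(k-r)}{2}.$$ Furthermore, $\mathrm{EX}(n,\overrightarrow{C_{k+1}})=\overrightarrow{\mathcal{F}_{n,k}}$ for $k\ge 3$.
   Context: Digraphs are finite and strict: no loops and no parallel arcs in the same direction, but both arcs $uv$ and $vu$ may be present. $a(D)$ denotes the number of arcs of a digraph $D$. $\overrightarrow{C_k}$ is the directed cycle with $k$ vertices (for $k=2$, it consists of two vertices $u,v$ and both arcs $uv,vu$). A digraph is $H$-free if it contains no (not necessarily induced) subdigraph isomorphic to the digraph $H$. $\mathrm{ex}(n,H)$ is the maximum number of arcs of an $H$-free digraph on $n$ vertices, and $\mathrm{EX}(n,H)$ is the family of all $H$-free digraphs on $n$ vertices with exactly $\mathrm{ex}(n,H)$ arcs. Families of digraphs are considered up to isomorphism. A digraph is complete if it contains the arc $uv$ for every ordered pair of distinct vertices $u,v$. For disjoint vertex sets $U,W$ of a digraph, $U\mapsto W$ means that $uw$ is an arc and $wu$ is not an arc for all $u\in U$, $w\in W$. For $n=qk+r$ with $0\le r<k$, put $q'=q$ if $r=0$ and $q'=q+1$ otherwise. $\overrightarrow{\mathcal{F}_{n,k}}$ is the set of all digraphs $\overrightarrow{F_{n,k}}$ on $n$ vertices whose vertex set has a partition $\{V_1,\dots,V_{q'}\}$ such that: (i) $|V_i|=k$ for all but at most one $V_i$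 (so, if $r>0$, exactly one part, in an arbitrary position, has size $r$); (ii) the subdigraph induced by each $V_i$ is complete; (iii) $V_i\mapsto V_j$ for all $1\le i<j\le q'$. All members of $\overrightarrow{\mathcal{F}_{n,k}}$ have the same number of arcs, denoted $a(\overrightarrow{F_{n,k}})$. *)

theory Defs
  imports
    Complex_Main
    "HOL-Library.Disjoint_Sets"
    "Graph_Theory.Digraph_Isomorphism"
    "Graph_Theory.Kuratowski"
begin

text \<open>
  A finite strict digraph is a record satisfying the locale \<open>pair_digraph\<close> (finite, loopfree;
  arcs are ordered pairs, so there are no parallel arcs). Every finite digraph has an isomorphic
  copy with vertices in \<^typ>\<open>nat\<close>, so families of digraphs ``up to isomorphism'' are represented
  by isomorphism-closed sets of digraphs over \<^typ>\<open>nat\<close>, with arbitrary vertex sets; equality of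
  two such sets is equality of the families up to isomorphism.
\<close>

abbreviation num_arcs :: "'a pair_pre_digraph \<Rightarrow> nat" where
  "num_arcs D \<equiv> card (parcs D)"

text \<open>Vertices \<open>0, \<dots>, k - 1\<close>; this is the intended digraph only for \<open>k \<ge> 2\<close>
  (for \<open>k = 1\<close> it would be a loop).\<close>

definition dicycle :: "nat \<Rightarrow> nat pair_pre_digraph" where
  "dicycle k = \<lparr> pverts = {..<k}, parcs = {(i, (i + 1) mod k) | i. i < k} \<rparr>"

definition free_of :: "'b pair_pre_digraph \<Rightarrow> 'a pair_pre_digraph \<Rightarrow> bool" where
  "free_of H D \<longleftrightarrow> \<not> (\<exists>S. subgraph S (with_proj D) \<and> digraph_iso S (with_proj H))"

definition free_digraphs :: "nat \<Rightarrow> 'b pair_pre_digraph \<Rightarrow> nat pair_pre_digraph set" where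
  "free_digraphs n H = {D. pair_digraph D \<and> card (pverts D) = n \<and> free_of H D}"

definition ex_number :: "nat \<Rightarrow> 'b pair_pre_digraph \<Rightarrow> nat" where
  "ex_number n H = Max (num_arcs ` free_digraphs n H)"

definition EX_family :: "nat \<Rightarrow> 'b pair_pre_digraph \<Rightarrow> nat pair_pre_digraph set" where
  "EX_family n H = {D \<in> free_digraphs n H. num_arcs D = ex_number n H}"

definition maps_to :: "'a pair_pre_digraph \<Rightarrow> 'a set \<Rightarrow> 'a set \<Rightarrow> bool" where
  "maps_to D U W \<longleftrightarrow> (\<forall>u\<in>U. \<forall>w\<in>W. (u, w) \<in> parcs D \<and> (w, u) \<notin> parcs D)"

definition num_parts :: "nat \<Rightarrow> nat \<Rightarrow> nat" where
  "num_parts n k = (if n mod k = 0 then n div k else n div k + 1)"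

definition F_family :: "nat \<Rightarrow> nat \<Rightarrow> nat pair_pre_digraph set" where
  "F_family n k = {D. pair_digraph D \<and> card (pverts D) = n \<and>
     (\<exists>V :: nat \<Rightarrow> nat set. let I = {1..num_parts n k} in
        partition_on (pverts D) (V ` I) \<and> inj_on V I \<and>
        card {i \<in> I. card (V i) \<noteq> k} \<le> 1 \<and>
        (\<forall>i\<in>I. complete_digraph (card (V i)) (induce_subgraph (with_proj D) (V i))) \<and>
        (\<forall>i\<in>I. \<forall>j\<in>I. i < j \<longrightarrow> maps_to D (V i) (V j)))}"

end

theory Submission
  imports Defs
begin

text \<open>
  Let \<open>D\<close> be free of \<open>C_{k+1}\<close>. If \<open>D\<close> contains a \<open>C_k\<close> on the vertex set \<open>C\<close>, then a vertex \<open>v\<close> outside \<open>C\<close>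
  cannot be inserted between consecutive vertices of that cycle, so at most \<open>k\<close> arcs join \<open>v\<close> to \<open>C\<close>;
  deleting \<open>C\<close> removes at most \<open>k(n - 1)\<close> arcs, which is exactly the increment of the claimed
  bound from \<open>n - k\<close> to \<open>n\<close>. If \<open>D\<close> has no \<open>C_k\<close>, the bound for \<open>k - 1\<close> applies, and it is strictly
  smaller as soon as \<open>n \<ge> k\<close>. So an extremal \<open>D\<close> contains a \<open>C_k\<close> and all these inequalities are
  equalities: \<open>C\<close> is complete and, for \<open>k \<ge> 3\<close>, every other vertex dominates \<open>C\<close> or is dominated
  by it. An arc from the dominated to the dominating vertices would close a \<open>C_{k+1}\<close>, hence \<open>C\<close>
  fits as a new part into the ordered partition of \<open>D - C\<close> given by induction.
\<close>

section \<open>Directed cycles as lists\<close>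

text \<open>The closing arc is kept apart from the path so that lists built by appending are easy to
  check. Each cycle occurs once per rotation; a singleton list would be a loop.\<close>

definition dicyc :: "'a rel \<Rightarrow> 'a list \<Rightarrow> bool" where
  "dicyc E xs \<longleftrightarrow> xs \<noteq> [] \<and> distinct xs \<and> successively (\<lambda>x y. (x, y) \<in> E) xs \<and> (last xs, hd xs) \<in> E"

lemma dicyc_conv_nth:
  "dicyc E xs \<longleftrightarrow> xs \<noteq> [] \<and> distinct xs \<and> (\<forall>i<length xs. (xs ! i, xs ! (Suc i mod length xs)) \<in> E)"
proof (cases "xs = []")
  case False
  then obtain m where m: "length xs = Suc m"
    by (cases xs) auto
  have "(\<forall>i<length xs. (xs ! i, xs ! (Suc i mod length xs)) \<in> E) \<longleftrightarrow>
    (\<forall>i<m. (xs ! i, xs ! (Suc i)) \<in> E) \<and> (xs ! m, xs ! 0) \<in> E"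
    unfolding m less_Suc_eq by auto
  with False show ?thesis
    by (simp add: dicyc_def successively_conv_nth last_conv_nth hd_conv_nth m)
qed (simp add: dicyc_def)

lemma dicyc_rotate:
  assumes "dicyc E xs"
  shows "dicyc E (rotate s xs)"
proof (induction s)
  case (Suc s)
  have "dicyc E (rotate1 ys)" if "dicyc E ys" for ys
    using that by (cases ys) (auto simp: dicyc_def successively_append_iff successively_Cons hd_append split: if_splits)
  with Suc show ?case by simp
qed (use assms in simp)

text \<open>Inserting \<open>v\<close> between two consecutive vertices lengthens the cycle by one.
  The rotation puts \<open>xs ! i\<close> last, so the insertion becomes an append.\<close>

lemma dicyc_snoc:
  assumes "dicyc E xs" "i < length xs" "v \<notin> set xs"
    and "(xs ! i, v) \<in> E" "(v, xs ! (Suc i mod length xs)) \<in> E"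
  shows "dicyc E (rotate (Suc i) xs @ [v])"
proof -
  let ?ys = "rotate (Suc i) xs"
  have ys: "dicyc E ?ys" using assms(1) by (rule dicyc_rotate)
  have ne: "xs \<noteq> []" using assms(1) by (simp add: dicyc_def)
  then have "hd ?ys = xs ! (Suc i mod length xs)"
    by (rule hd_rotate_conv_nth)
  moreover have "last ?ys = xs ! i"
  proof -
    have "last ?ys = ?ys ! (length xs - 1)"
      using ne by (simp add: last_conv_nth del: rotate_Suc)
    also have "\<dots> = xs ! ((Suc i + (length xs - 1)) mod length xs)"
      using ne by (intro nth_rotate) simp
    also have "Suc i + (length xs - 1) = i + length xs" using ne by (cases xs) auto
    finally show ?thesis using assms(2) by simp
  qed
  ultimately show ?thesis
    using ys assms ne by (simp add: dicyc_def successively_append_iff del: rotate_Suc)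
qed

text \<open>Record each in-neighbour of \<open>v\<close> at its own position and each out-neighbour
  at the position before it. A position recorded twice would allow \<open>v\<close> to be inserted
  there, so the two index sets are disjoint subsets of \<open>{..<length xs}\<close>.\<close>

lemma card_arcs_vertex_dicyc_le:
  assumes c: "dicyc E xs" and v: "v \<notin> set xs"
    and free: "\<And>ys. dicyc E ys \<Longrightarrow> length ys \<noteq> Suc (length xs)"
  shows "card {x \<in> set xs. (x, v) \<in> E} + card {x \<in> set xs. (v, x) \<in> E} \<le> length xs"
proof -
  let ?k = "length xs" and ?\<sigma> = "\<lambda>i. Suc i mod length xs"
  let ?I = "{i. i < ?k \<and> (xs ! i, v) \<in> E}" and ?J = "{i. i < ?k \<and> (v, xs ! ?\<sigma> i) \<in> E}"
  have k: "?k > 0" using c by (simp add: dicyc_def)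
  have "?I \<inter> ?J = {}"
    using dicyc_snoc[OF c _ v] free[of "rotate (Suc i) xs @ [v]" for i] by fastforce
  then have "card ?I + card ?J = card (?I \<union> ?J)" by (simp add: card_Un_disjoint)
  also have "\<dots> \<le> card {..<?k}" by (intro card_mono) auto
  finally have "card ?I + card ?J \<le> ?k" by simp
  moreover have "{x \<in> set xs. (x, v) \<in> E} \<subseteq> (\<lambda>i. xs ! i) ` ?I"
    by (auto simp: in_set_conv_nth)
  then have "card {x \<in> set xs. (x, v) \<in> E} \<le> card ?I"
    by (rule surj_card_le[rotated]) simp
  moreover have "{x \<in> set xs. (v, x) \<in> E} \<subseteq> (\<lambda>i. xs ! ?\<sigma> i) ` ?J"
  proof
    fix x assume x: "x \<in> {x \<in> set xs. (v, x) \<in> E}"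
    then obtain j where j: "j < ?k" "x = xs ! j" by (auto simp: in_set_conv_nth)
    \<comment> \<open>The cyclic predecessor of \<open>j\<close>; adding \<open>?k - 1\<close>
      instead of subtracting 1 also covers \<open>j = 0\<close>.\<close>
    have "j = ?\<sigma> ((j + (?k - 1)) mod ?k)"
      using j(1) k by (simp add: mod_Suc_eq)
    moreover have "(j + (?k - 1)) mod ?k < ?k" using k by simp
    ultimately show "x \<in> (\<lambda>i. xs ! ?\<sigma> i) ` ?J" using x j by force
  qed
  then have "card {x \<in> set xs. (v, x) \<in> E} \<le> card ?J"
    by (rule surj_card_le[rotated]) simp
  ultimately show ?thesis by linarith
qed

text \<open>Any ordering of a complete set is a directed path, so only the two arcs joining it to
  the path \<open>ys\<close> need checking.\<close>

lemma dicyc_snoc_complete: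
  assumes xs: "xs \<noteq> []" "distinct xs" "set xs \<times> set xs - Id \<subseteq> E"
    and ys: "ys \<noteq> []" "distinct ys" "set ys \<inter> set xs = {}" "successively (\<lambda>x y. (x, y) \<in> E) ys"
    and "(last xs, hd ys) \<in> E" "(last ys, hd xs) \<in> E"
  shows "dicyc E (xs @ ys)"
proof -
  have "successively (\<lambda>x y. (x, y) \<in> E) xs"
    using xs(2,3) by (induction xs) (auto simp: successively_Cons neq_Nil_conv)
  then show ?thesis
    using assms by (auto simp: dicyc_def successively_append_iff)
qed

section \<open>The upper bound\<close>

lemma card_offdiag:
  assumes "finite C"
  shows "card (C \<times> C - Id) = card C * (card C - 1)"
proof -
  have "C \<times> C \<inter> Id = (\<lambda>x. (x, x)) ` C" by auto
  then have "card (C \<times> C \<inter> Id) = card C" by (simp add: card_image inj_on_def)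
  then show ?thesis
    using assms by (simp add: card_Diff_subset_Int card_cartesian_product diff_mult_distrib2)
qed

text \<open>Arcs are sorted by which endpoints lie in \<open>C\<close>; those between
  \<open>C\<close> and the rest are counted at their endpoint outside \<open>C\<close>.\<close>

lemma card_arcs_split:
  assumes V: "finite V" "E \<subseteq> V \<times> V" "C \<subseteq> V"
  shows "card E = card (E \<inter> C \<times> C) + card (E \<inter> (V - C) \<times> (V - C))
    + (\<Sum>v\<in>V - C. card {x \<in> C. (x, v) \<in> E} + card {x \<in> C. (v, x) \<in> E})"
proof -
  let ?W = "V - C"
  have fin: "finite E" using V finite_subset by blast
  have finC: "finite C" using V finite_subset by blast
  have "E = (E \<inter> C \<times> C) \<union> (E \<inter> ?W \<times> ?W) \<union> ((E \<inter> C \<times> ?W) \<union> (E \<inter> ?W \<times> C))"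
    using V by auto
  also have "card \<dots> = card (E \<inter> C \<times> C) + card (E \<inter> ?W \<times> ?W)
      + (card (E \<inter> C \<times> ?W) + card (E \<inter> ?W \<times> C))"
    using fin by (subst card_Un_disjoint; (simp; fail)?; auto)+
  also have "card (E \<inter> ?W \<times> C) = (\<Sum>v\<in>?W. card {x \<in> C. (v, x) \<in> E})"
  proof -
    have "E \<inter> ?W \<times> C = (SIGMA v:?W. {x \<in> C. (v, x) \<in> E})" by auto
    then show ?thesis using V finC by simp
  qed
  also have "card (E \<inter> C \<times> ?W) = (\<Sum>v\<in>?W. card {x \<in> C. (x, v) \<in> E})"
  proof -
    have "E \<inter> C \<times> ?W = prod.swap ` (SIGMA v:?W. {x \<in> C. (x, v) \<in> E})" by force
    then show ?thesis using V finC by (simp add: card_image)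
  qed
  finally show ?thesis by (simp add: sum.distrib)
qed

lemma dicyc_vertices:
  assumes "dicyc E xs" "finite V" "E \<subseteq> V \<times> V" "irrefl E"
  shows "set xs \<subseteq> V" "card (set xs) = length xs"
    and "card (E \<inter> set xs \<times> set xs) \<le> length xs * (length xs - 1)"
proof -
  show "set xs \<subseteq> V"
    using assms by (fastforce simp: dicyc_conv_nth in_set_conv_nth)
  show card: "card (set xs) = length xs"
    using assms by (simp add: dicyc_def distinct_card)
  have "card (E \<inter> set xs \<times> set xs) \<le> card (set xs \<times> set xs - Id)"
    using assms(4) by (intro card_mono) (auto simp: irrefl_def)
  then show "card (E \<inter> set xs \<times> set xs) \<le> length xs * (length xs - 1)"
    by (simp add: card_offdiag card)
qed

section \<open>Arithmetic of the claimed bound\<close>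

text \<open>Twice the number of arcs of \<open>F_{n,k}\<close>.\<close>

definition twice_F_arcs :: "nat \<Rightarrow> nat \<Rightarrow> int" where
  "twice_F_arcs n k = int n * (int n - 1) + int (n div k) * (int k * (int k - 1))
     + int (n mod k) * (int (n mod k) - 1)"

lemma twice_F_arcs_small: "n \<le> k \<Longrightarrow> twice_F_arcs n k = 2 * (int n * (int n - 1))"
  by (cases "n = k"; cases "k = 0") (auto simp: twice_F_arcs_def)

text \<open>Removing a full part loses \<open>k * (k - 1)\<close> inner arcs and \<open>k\<close>
  arcs for each of the other \<open>n - k\<close> vertices, hence \<open>k * (n - 1)\<close> in
  all.\<close>

lemma twice_F_arcs_rec:
  assumes "k \<ge> 1" "n \<ge> k"
  shows "twice_F_arcs n k = twice_F_arcs (n - k) k + 2 * int k * (int n - 1)"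
proof -
  from assms(2) obtain m where n: "n = m + k" by (metis le_add_diff_inverse2)
  show ?thesis using assms(1) by (simp add: n twice_F_arcs_def div_add_self2 algebra_simps)
qed

text \<open>A new vertex has one arc with each of the \<open>n\<close> old vertices and at most
  \<open>k - 1\<close> further arcs, the reverse ones inside its own part. Formally the recurrence
  is applied on both sides.\<close>

lemma twice_F_arcs_Suc:
  assumes "k \<ge> 1"
  shows "twice_F_arcs (Suc n) k \<le> twice_F_arcs n k + 2 * (int n + int k - 1)"
proof (induction n rule: less_induct)
  case (less n)
  show ?case
  proof (cases "n < k")
    case True
    then show ?thesis by (simp add: twice_F_arcs_small algebra_simps)
  next
    case False
    then show ?thesis
      using less[of "n - k"] assms by (simp add: twice_F_arcs_rec[of k n] twice_F_arcs_rec[of k "Suc n"] Suc_diff_le algebra_simps)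
  qed
qed

text \<open>For \<open>n = m + Suc k\<close>, peel a part of size \<open>Suc k\<close> on the right
  and one of size \<open>k\<close> on the left. The remainders have \<open>m\<close> and
  \<open>Suc m\<close> vertices, and the cost of that extra vertex is at least one arc below the
  gain \<open>n - 1\<close> from the larger part. This gives strictness from the weak inequality at
  \<open>m\<close> alone.\<close>

lemma twice_F_arcs_mono: "k \<ge> 1 \<Longrightarrow> twice_F_arcs n k \<le> twice_F_arcs n (Suc k)"
  and twice_F_arcs_strict_mono: "k \<ge> 1 \<Longrightarrow> n > k \<Longrightarrow> twice_F_arcs n k < twice_F_arcs n (Suc k)"
proof -
  have *: "twice_F_arcs n k \<le> twice_F_arcs n (Suc k) \<and> (n > k \<longrightarrow> twice_F_arcs n k < twice_F_arcs n (Suc k))" if k: "k \<ge> 1"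
  proof (induction n rule: less_induct)
    case (less n)
    show ?case
    proof (cases "n \<le> k")
      case False
      then obtain m where n: "n = m + Suc k" using less_imp_Suc_add[of k n] by auto
      have "twice_F_arcs n (Suc k) = twice_F_arcs m (Suc k) + 2 * (int k + 1) * (int n - 1)"
        using twice_F_arcs_rec[of "Suc k" n] n by simp
      moreover have "twice_F_arcs n k = twice_F_arcs (Suc m) k + 2 * int k * (int n - 1)"
        using twice_F_arcs_rec[of k n] n k by simp
      moreover have "twice_F_arcs m k \<le> twice_F_arcs m (Suc k)" using less[of m] n by simp
      ultimately show ?thesis using twice_F_arcs_Suc[OF k, of m] n by (simp add: algebra_simps)
    qed (simp add: twice_F_arcs_small)
  qed
  show "k \<ge> 1 \<Longrightarrow> twice_F_arcs n k \<le> twice_F_arcs n (Suc k)" "k \<ge> 1 \<Longrightarrow> n > k \<Longrightarrow> twice_F_arcs n k < twice_F_arcs n (Suc k)"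
    using * by auto
qed

text \<open>Outer induction on \<open>k\<close>, which settles digraphs without a cycle one shorter
  than the forbidden one; inner induction on \<open>card V\<close>, which settles the rest by
  deleting such a cycle.\<close>

lemma card_arcs_le:
  assumes "finite V" "E \<subseteq> V \<times> V" "irrefl E" "k \<ge> 1"
    and "\<And>xs. dicyc E xs \<Longrightarrow> length xs \<noteq> Suc k"
  shows "2 * int (card E) \<le> twice_F_arcs (card V) k"
  using assms(4,1-3,5)
proof (induction k arbitrary: V E rule: nat_induct_at_least)
  case base
  \<comment> \<open>For \<open>k = 1\<close> the forbidden cycle is a pair of opposite arcs.\<close>
  have "(x, y) \<notin> E \<or> (y, x) \<notin> E" for x y
  proof -
    have "\<not> dicyc E [x, y]" using base.prems(4)[of "[x, y]"] by auto
    then show ?thesis using base.prems(3) by (auto simp: dicyc_def irrefl_def)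
  qed
  then have "E \<inter> E\<inverse> = {}" by auto
  moreover have fin: "finite E" using base.prems finite_subset by blast
  ultimately have "card (E \<union> E\<inverse>) = 2 * card E"
    by (simp add: card_Un_disjoint)
  moreover have "E \<union> E\<inverse> \<subseteq> V \<times> V - Id"
    using base.prems by (auto simp: irrefl_def)
  then have "card (E \<union> E\<inverse>) \<le> card (V \<times> V - Id)"
    using base.prems by (intro card_mono) auto
  ultimately have "2 * card E \<le> card V * (card V - 1)"
    using card_offdiag[OF base.prems(1)] by simp
  then have "int (2 * card E) \<le> int (card V * (card V - 1))" by linarith
  then show ?case by (cases "card V") (simp_all add: twice_F_arcs_def algebra_simps)
next
  case (Suc k)
  \<comment> \<open>Saved before the inner induction, because it is applied to the digraph
    considered there.\<close>
  note IHk = Suc.IH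
  show ?case
    using Suc.prems
  proof (induction "card V" arbitrary: V E rule: less_induct)
    case less
    note V = less.prems(1) and E = less.prems(2,3) and free = less.prems(4)
    show ?case
    proof (cases "\<exists>xs. dicyc E xs \<and> length xs = Suc k")
      case False
      then have "2 * int (card E) \<le> twice_F_arcs (card V) k" using IHk V E by blast
      also have "\<dots> \<le> twice_F_arcs (card V) (Suc k)" using Suc.hyps by (rule twice_F_arcs_mono)
      finally show ?thesis .
    next
      case True
      then obtain xs where xs: "dicyc E xs" "length xs = Suc k" by blast
      define C where "C = set xs"
      note C = dicyc_vertices[OF xs(1) V E, folded C_def, unfolded xs(2)]
      have W: "card (V - C) = card V - Suc k" "card V \<ge> Suc k"
        using C V card_mono[OF V C(1)] by (simp_all add: card_Diff_subset finite_subset)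
      have "2 * int (card (E \<inter> (V - C) \<times> (V - C))) \<le> twice_F_arcs (card (V - C)) (Suc k)"
      proof (rule less.hyps)
        show "card (V - C) < card V" using W by simp
        show "length ys \<noteq> Suc (Suc k)" if "dicyc (E \<inter> (V - C) \<times> (V - C)) ys" for ys
          using that free[of ys] by (auto simp: dicyc_conv_nth)
      qed (use V E in \<open>auto simp: irrefl_def\<close>)
      moreover have "(\<Sum>v\<in>V - C. card {x \<in> C. (x, v) \<in> E} + card {x \<in> C. (v, x) \<in> E})
          \<le> (\<Sum>v\<in>V - C. Suc k)"
        using card_arcs_vertex_dicyc_le[OF xs(1)] free xs(2) unfolding C_def
        by (intro sum_mono) auto
      then have 3: "(\<Sum>v\<in>V - C. card {x \<in> C. (x, v) \<in> E} + card {x \<in> C. (v, x) \<in> E})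
          \<le> (card V - Suc k) * Suc k" using W by simp
      have "card E \<le> Suc k * (Suc k - 1) + card (E \<inter> (V - C) \<times> (V - C)) + (card V - Suc k) * Suc k"
        using card_arcs_split[OF V E(1) C(1)] C(3) 3 by linarith
      then have "int (card E) \<le> int (Suc k * (Suc k - 1) + card (E \<inter> (V - C) \<times> (V - C)) + (card V - Suc k) * Suc k)"
        by (rule of_nat_mono)
      moreover obtain m where "card V = m + Suc k"
        using W(2) by (metis le_add_diff_inverse2)
      ultimately show ?thesis
        using twice_F_arcs_rec[of "Suc k" "card V"] W(1) by (simp add: algebra_simps)
    qed
  qed
qed

section \<open>Extremal digraphs\<close>

text \<open>The parts \<open>V_1, \<dots>, V_m\<close> of a member of the family, encoded as the fibres of a rank
  function with values \<open>0, \<dots>, m - 1\<close>.\<close>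

definition layered :: "'a set \<Rightarrow> 'a rel \<Rightarrow> nat \<Rightarrow> nat \<Rightarrow> ('a \<Rightarrow> nat) \<Rightarrow> bool" where
  "layered V E k m \<rho> \<longleftrightarrow> m = num_parts (card V) k \<and> \<rho> ` V = {..<m} \<and>
     E = {(u, v). u \<in> V \<and> v \<in> V \<and> u \<noteq> v \<and> \<rho> u \<le> \<rho> v} \<and>
     card {i. i < m \<and> card {v \<in> V. \<rho> v = i} \<noteq> k} \<le> 1"

text \<open>\<open>C\<close> becomes a new layer after all layers meeting \<open>A\<close> and
  before all layers meeting \<open>B\<close>. Such a place exists because arcs of \<open>E'\<close>
  follow the rank and none leads from \<open>B\<close> to \<open>A\<close>.\<close>

lemma layered_insert:
  assumes lay: "layered W E' k m \<rho>" and W: "finite W"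
    and C: "finite C" "C \<noteq> {}" "card C = k" "C \<inter> W = {}"
    and AB: "A \<union> B = W" "A \<inter> B = {}" "E' \<inter> B \<times> A = {}"
    and E: "E = E' \<union> (C \<times> C - Id) \<union> A \<times> C \<union> C \<times> B"
  shows "\<exists>\<rho>'. layered (C \<union> W) E k (Suc m) \<rho>'"
proof -
  \<comment> \<open>The least rank in \<open>B\<close>, or \<open>m\<close> if \<open>B\<close> is
    empty, in which case \<open>C\<close> becomes the last layer.\<close>
  define s where "s = (LEAST i. i = m \<or> i \<in> \<rho> ` B)"
  have s: "s = m \<or> s \<in> \<rho> ` B"
    unfolding s_def by (rule LeastI[where P = "\<lambda>i. i = m \<or> i \<in> \<rho> ` B" and k = m]) simp
  have sm: "s \<le> m" unfolding s_def by (rule Least_le) simp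
  have sB: "s \<le> \<rho> b" if "b \<in> B" for b unfolding s_def by (rule Least_le) (use that in simp)
  have m: "Suc m = num_parts (card (C \<union> W)) k"
  proof -
    have "k > 0" using C by auto
    moreover have "card (C \<union> W) = card W + k" using W C by (simp add: card_Un_disjoint)
    moreover have "m = num_parts (card W) k" using lay by (simp add: layered_def)
    ultimately show ?thesis by (simp add: num_parts_def div_add_self2)
  qed
  have im: "\<rho> ` W = {..<m}" and E': "E' = {(u, v). u \<in> W \<and> v \<in> W \<and> u \<noteq> v \<and> \<rho> u \<le> \<rho> v}"
    and ex: "card {i. i < m \<and> card {v \<in> W. \<rho> v = i} \<noteq> k} \<le> 1"
    using lay by (auto simp: layered_def)
  \<comment> \<open>Otherwise some \<open>b\<close> in \<open>B\<close> of rank \<open>s\<close>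
    would have an arc to \<open>a\<close>.\<close>
  have sA: "\<rho> a < s" if "a \<in> A" for a
    using s
  proof
    assume "s = m"
    then show ?thesis using im that AB(1) by auto
  next
    assume "s \<in> \<rho> ` B"
    then obtain b where b: "b \<in> B" "s = \<rho> b" by blast
    then have "(b, a) \<notin> E'" using AB(3) that by blast
    then show ?thesis using b that AB unfolding E' by (auto simp: not_le)
  qed
  \<comment> \<open>Opens a gap at rank \<open>s\<close> and keeps the order of the other
    ranks.\<close>
  define shift where "shift i = (if i < s then i else Suc i)" for i
  define \<rho>' where "\<rho>' v = (if v \<in> C then s else shift (\<rho> v))" for v
  have shift: "i < s \<Longrightarrow> shift i = i" "\<not> i < s \<Longrightarrow> shift i = Suc i" for i
    by (simp_all add: shift_def)
  have shift_le: "shift i \<le> shift j \<longleftrightarrow> i \<le> j" and shift_eq: "shift i = shift j \<longleftrightarrow> i = j"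
    and shift_ne: "shift i \<noteq> s" for i j
    by (auto simp: shift_def)
  have shift_surj: "i = s \<or> i \<in> shift ` {..<m}" if "i < Suc m" for i
  proof (cases "i \<le> s")
    case True
    then show ?thesis using sm by (auto simp: shift_def image_iff intro!: bexI[of _ i])
  next
    case False
    then show ?thesis using that by (auto simp: shift_def image_iff intro!: bexI[of _ "i - 1"])
  qed
  have \<rho>'C: "v \<in> C \<Longrightarrow> \<rho>' v = s" and \<rho>'W: "v \<in> W \<Longrightarrow> \<rho>' v = shift (\<rho> v)" for v
    using C(4) by (auto simp: \<rho>'_def)
  have "\<rho>' ` W = shift ` \<rho> ` W" unfolding image_image by (intro image_cong) (auto simp: \<rho>'W)
  then have "\<rho>' ` (C \<union> W) = insert s (shift ` {..<m})"
    using C(2) \<rho>'C by (auto simp: image_Un im)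
  also have "\<dots> = {..<Suc m}"
    using sm shift_surj by (auto simp: shift_def split: if_splits)
  finally have 1: "\<rho>' ` (C \<union> W) = {..<Suc m}" .
  have 2: "(u, v) \<in> E \<longleftrightarrow> u \<in> C \<union> W \<and> v \<in> C \<union> W \<and> u \<noteq> v \<and> \<rho>' u \<le> \<rho>' v" for u v
  proof -
    \<comment> \<open>As \<open>shift\<close> never takes the value \<open>s\<close>, comparing with
      \<open>s\<close> separates \<open>A\<close> from \<open>B\<close> exactly.\<close>
    have A: "v \<in> A \<longleftrightarrow> v \<in> W \<and> shift (\<rho> v) \<le> s" and B: "v \<in> B \<longleftrightarrow> v \<in> W \<and> s \<le> shift (\<rho> v)" for v
      using sA[of v] sB[of v] AB by (auto simp: shift_def split: if_splits)
    have "u \<in> C \<Longrightarrow> u \<notin> W" "v \<in> C \<Longrightarrow> v \<notin> W" using C(4) by auto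
    then show ?thesis
      unfolding E E' using A[of u] B[of v] \<rho>'C[of u] \<rho>'C[of v] \<rho>'W[of u] \<rho>'W[of v]
      by (auto simp: shift_le)
  qed
  \<comment> \<open>The new layer has exactly \<open>k\<close> vertices, so every exceptional layer
    is an old one.\<close>
  have "{i. i < Suc m \<and> card {v \<in> C \<union> W. \<rho>' v = i} \<noteq> k}
      \<subseteq> shift ` {i. i < m \<and> card {v \<in> W. \<rho> v = i} \<noteq> k}"
  proof
    fix i assume i: "i \<in> {i. i < Suc m \<and> card {v \<in> C \<union> W. \<rho>' v = i} \<noteq> k}"
    have "{v \<in> C \<union> W. \<rho>' v = s} = C"
      using \<rho>'C \<rho>'W shift_ne by (auto dest: sym)
    then have "i \<noteq> s" using i C(3) by auto
    then obtain j where j: "j < m" "i = shift j" using shift_surj[of i] i by auto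
    have "{v \<in> C \<union> W. \<rho>' v = i} = {v \<in> W. \<rho> v = j}"
      using \<rho>'C \<rho>'W shift_ne[of j] j by (auto simp: shift_eq)
    then show "i \<in> shift ` {i. i < m \<and> card {v \<in> W. \<rho> v = i} \<noteq> k}" using i j by auto
  qed
  then have "card {i. i < Suc m \<and> card {v \<in> C \<union> W. \<rho>' v = i} \<noteq> k}
      \<le> card {i. i < m \<and> card {v \<in> W. \<rho> v = i} \<noteq> k}"
    by (rule surj_card_le[rotated]) simp
  with ex have 3: "card {i. i < Suc m \<and> card {v \<in> C \<union> W. \<rho>' v = i} \<noteq> k} \<le> 1" by linarith
  have "layered (C \<union> W) E k (Suc m) \<rho>'"
    unfolding layered_def using m 1 2 3 by auto
  then show ?thesis by blast
qed

section \<open>Cycles forced by a complete vertex set\<close>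

text \<open>A path through all of \<open>C\<close> from \<open>y\<close> to \<open>x\<close> is
  closed through \<open>v\<close>; it needs \<open>x\<close> and \<open>y\<close> to be
  distinct.\<close>

lemma dicyc_complete_vertex:
  assumes C: "finite C" "C \<times> C - Id \<subseteq> E" and v: "v \<notin> C"
    and xy: "x \<in> C" "y \<in> C" "x \<noteq> y" "(x, v) \<in> E" "(v, y) \<in> E"
  shows "\<exists>ys. dicyc E ys \<and> length ys = Suc (card C)"
proof -
  obtain zs where zs: "set zs = C - {x, y}" "distinct zs"
    using C(1) finite_distinct_list[of "C - {x, y}"] by auto
  let ?xs = "y # zs @ [x]"
  have set: "set ?xs = C" using zs xy by auto
  moreover have d: "distinct ?xs" using zs xy by auto
  ultimately have "length ?xs = card C" using distinct_card[OF d] by simp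
  moreover have "dicyc E (?xs @ [v])"
    by (rule dicyc_snoc_complete) (use d v xy C in \<open>simp_all only: set, auto\<close>)
  ultimately show ?thesis by (intro exI[of _ "?xs @ [v]"]) simp
qed

text \<open>Replace one vertex of \<open>C\<close> by the two vertices \<open>b\<close>,
  \<open>a\<close>: traverse the rest of \<open>C\<close>, then go to \<open>b\<close>, to
  \<open>a\<close>, and back.\<close>

lemma dicyc_complete_arc:
  assumes C: "finite C" "C \<times> C - Id \<subseteq> E" "card C \<ge> 2"
    and ab: "a \<notin> C" "b \<notin> C" "a \<noteq> b" "(b, a) \<in> E" "{a} \<times> C \<subseteq> E" "C \<times> {b} \<subseteq> E"
  shows "\<exists>ys. dicyc E ys \<and> length ys = Suc (card C)"
proof -
  obtain x where x: "x \<in> C" using C by (cases "C = {}") auto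
  obtain zs where zs: "set zs = C - {x}" "distinct zs"
    using C(1) finite_distinct_list[of "C - {x}"] by auto
  have l: "length zs = card C - 1" using distinct_card[OF zs(2)] zs(1) x C(1) by simp
  then have ne: "zs \<noteq> []" using C(3) by auto
  then have hl: "hd zs \<in> C" "last zs \<in> C" using zs(1) hd_in_set last_in_set by blast+
  have "dicyc E (zs @ [b, a])"
    by (rule dicyc_snoc_complete) (use zs ne hl ab C in auto)
  moreover have "length (zs @ [b, a]) = Suc (card C)" using l C(3) by simp
  ultimately show ?thesis by blast
qed

text \<open>The vertex-deletion step of \<open>card_arcs_le\<close> read for equality. The condition
  \<open>k \<ge> 3\<close> excludes an outside vertex whose only arcs with \<open>C\<close> are the
  two opposite ones to a single vertex.\<close>

theorem layered_if_card_arcs_max: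
  assumes "finite V" "E \<subseteq> V \<times> V" "irrefl E" "k \<ge> 3"
    and "\<And>xs. dicyc E xs \<Longrightarrow> length xs \<noteq> Suc k"
    and "2 * int (card E) = twice_F_arcs (card V) k"
  shows "\<exists>m \<rho>. layered V E k m \<rho>"
  using assms
proof (induction "card V" arbitrary: V E rule: less_induct)
  case less
  note V = less.prems(1) and E = less.prems(2,3) and k = less.prems(4) and free = less.prems(5)
    and max = less.prems(6)
  have finE: "finite E" using E V finite_subset by blast
  show ?case
  proof (cases "card V \<le> k")
    case True
    have "int (card E) = int (card V * (card V - 1))"
      using max True by (cases "card V") (simp_all add: twice_F_arcs_small algebra_simps)
    moreover have "E \<subseteq> V \<times> V - Id" using E by (auto simp: irrefl_def)
    moreover have "card E = card V * (card V - 1)"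
      using calculation(1) by (simp only: of_nat_eq_iff)
    ultimately have "E = V \<times> V - Id"
      using V by (intro card_subset_eq) (auto simp: card_offdiag)
    \<comment> \<open>A single layer of rank 0, or none if \<open>V\<close> is empty; if it has
      fewer than \<open>k\<close> vertices, it is the one permitted exception.\<close>
    moreover have "card {i::nat. i < (if V = {} then 0 else 1) \<and> card {v \<in> V. 0 = i} \<noteq> k} \<le> card {0::nat}"
      by (intro card_mono) (auto split: if_splits)
    moreover have "num_parts (card V) k = (if V = {} then 0 else 1)"
      using True V k by (cases "card V = k") (auto simp: num_parts_def)
    ultimately have "layered V E k (if V = {} then 0 else 1) (\<lambda>_. 0)"
      by (auto simp: layered_def)
    then show ?thesis by blast
  next
    case False
    have "\<exists>xs. dicyc E xs \<and> length xs = k"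
    proof (rule ccontr)
      assume "\<not> ?thesis"
      then have "2 * int (card E) \<le> twice_F_arcs (card V) (k - 1)"
        using card_arcs_le[OF V E, of "k - 1"] k by auto
      also have "\<dots> < twice_F_arcs (card V) k"
        using twice_F_arcs_strict_mono[of "k - 1" "card V"] k False by simp
      finally show False using max by simp
    qed
    then obtain xs where xs: "dicyc E xs" "length xs = k" by blast
    define C where "C = set xs"
    note C = dicyc_vertices[OF xs(1) V E, folded C_def, unfolded xs(2)]
    let ?W = "V - C" and ?E' = "E \<inter> (V - C) \<times> (V - C)"
    let ?d = "\<lambda>v. card {x \<in> C. (x, v) \<in> E} + card {x \<in> C. (v, x) \<in> E}"
    have finC: "finite C" by (simp add: C_def)
    obtain l where l: "card V = l + k" using False by (metis le_add_diff_inverse2 nat_le_linear)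
    have W: "card ?W = l" using C l finC by (simp add: card_Diff_subset)
    have freeW: "length ys \<noteq> Suc k" if "dicyc ?E' ys" for ys
      using that free[of ys] by (auto simp: dicyc_conv_nth)
    have E': "?E' \<subseteq> ?W \<times> ?W" "irrefl ?E'" using E by (auto simp: irrefl_def)
    have E'_le: "2 * int (card ?E') \<le> twice_F_arcs (card ?W) k"
      using E' V k freeW by (intro card_arcs_le) auto
    have d_le: "?d v \<le> k" if "v \<in> ?W" for v
      using card_arcs_vertex_dicyc_le[OF xs(1), of v] free xs(2) that unfolding C_def by auto
    then have sum_le: "(\<Sum>v\<in>?W. ?d v) \<le> l * k"
      using sum_mono[of ?W ?d "\<lambda>_. k"] W by simp
    have split: "card E = card (E \<inter> C \<times> C) + card ?E' + (\<Sum>v\<in>?W. ?d v)"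
      using card_arcs_split[OF V E(1) C(1)] by simp
    have total: "2 * int (card E) = twice_F_arcs (card ?W) k + 2 * int (k * (k - 1)) + 2 * int (l * k)"
      using max twice_F_arcs_rec[of k "card V"] k l W by (simp add: of_nat_diff algebra_simps)
    \<comment> \<open>Upper bounds on three summands whose total is attained must all be attained.
      Stated for variables, so that the products in its instances are atoms.\<close>
    have linear: "a = b \<and> 2 * c = d \<and> e = f"
      if "a \<le> b" "e \<le> f" "t = 2 * a + 2 * c + 2 * e" "t = d + 2 * b + 2 * f" "2 * c \<le> d"
      for a b c d e f t :: int
      using that by linarith
    have "int (card (E \<inter> C \<times> C)) \<le> int (k * (k - 1))" "int (\<Sum>v\<in>?W. ?d v) \<le> int (l * k)"
      using C(3) sum_le by (simp_all only: of_nat_le_iff)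
    moreover have "2 * int (card E) = 2 * int (card (E \<inter> C \<times> C)) + 2 * int (card ?E') + 2 * int (\<Sum>v\<in>?W. ?d v)"
      unfolding split by simp
    ultimately have "int (card (E \<inter> C \<times> C)) = int (k * (k - 1)) \<and> 2 * int (card ?E') = twice_F_arcs (card ?W) k
        \<and> int (\<Sum>v\<in>?W. ?d v) = int (l * k)"
      using linear[OF _ _ _ total E'_le] by blast
    then have eqs: "card (E \<inter> C \<times> C) = k * (k - 1)" "2 * int (card ?E') = twice_F_arcs (card ?W) k"
        "(\<Sum>v\<in>?W. ?d v) = l * k"
      by (simp_all only: of_nat_eq_iff)
    have CC: "E \<inter> C \<times> C = C \<times> C - Id"
      using E(2) finC C(2) eqs(1) by (intro card_subset_eq) (auto simp: card_offdiag irrefl_def)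
    have d: "?d v = k" if "v \<in> ?W" for v
    proof (rule ccontr)
      assume "?d v \<noteq> k"
      then have "(\<Sum>v\<in>?W. ?d v) < (\<Sum>v\<in>?W. k)"
        using d_le[OF that] by (intro sum_strict_mono_ex1 ballI d_le bexI[OF _ that]) (simp_all add: V)
      then show False using eqs(3) W by simp
    qed
    define A where "A = {v \<in> ?W. {v} \<times> C \<subseteq> E \<and> C \<times> {v} \<inter> E = {}}"
    define B where "B = {v \<in> ?W. C \<times> {v} \<subseteq> E \<and> {v} \<times> C \<inter> E = {}}"
    have AB: "v \<in> A \<or> v \<in> B" if v: "v \<in> ?W" for v
    proof -
      let ?X = "{x \<in> C. (x, v) \<in> E}" and ?Y = "{x \<in> C. (v, x) \<in> E}"
      \<comment> \<open>An in-neighbour and a different out-neighbour of \<open>v\<close> in the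
        complete set \<open>C\<close> would yield a cycle of length \<open>k + 1\<close>.\<close>
      have "x = y" if "x \<in> ?X" "y \<in> ?Y" for x y
        using dicyc_complete_vertex[OF finC, of E v x y] CC C(2) free v that by blast
      then have "?X = {} \<or> ?Y = {} \<or> (\<exists>x. ?X \<subseteq> {x} \<and> ?Y \<subseteq> {x})" by blast
      then consider "?X = {}" | "?Y = {}" | x where "?X \<subseteq> {x}" "?Y \<subseteq> {x}" by blast
      then show ?thesis
      proof cases
        case 1
        then have "card ?Y = card C" using d[OF v] C(2) by (simp only: card.empty add_0 add_0_right)
        then have "?Y = C" using finC by (intro card_subset_eq) auto
        then show ?thesis using 1 v by (auto simp: A_def)
      next
        case 2
        then have "card ?X = card C" using d[OF v] C(2) by (simp only: card.empty add_0 add_0_right)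
        then have "?X = C" using finC by (intro card_subset_eq) auto
        then show ?thesis using 2 v by (auto simp: B_def)
      next
        \<comment> \<open>At most two arcs join \<open>v\<close> to \<open>C\<close> here, against
          the required \<open>k\<close>.\<close>
        case 3
        then have "card ?X + card ?Y \<le> card {x} + card {x}"
          by (intro add_mono card_mono) (simp_all only: finite.intros)
        then show ?thesis using d[OF v] k by simp
      qed
    qed
    have Cne: "C \<noteq> {}" using C(2) k by auto
    have BA: "(b, a) \<notin> E" if ab: "a \<in> A" "b \<in> B" for a b
    proof
      assume "(b, a) \<in> E"
      moreover have "a \<noteq> b" using E(2) calculation by (auto simp: irrefl_def)
      moreover have "a \<notin> C" "{a} \<times> C \<subseteq> E" using ab by (auto simp: A_def)
      moreover have "b \<notin> C" "C \<times> {b} \<subseteq> E" using ab by (auto simp: B_def)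
      moreover have "C \<times> C - Id \<subseteq> E" "card C \<ge> 2" using CC C(2) k by auto
      ultimately have "\<exists>ys. dicyc E ys \<and> length ys = Suc (card C)"
        using finC by (intro dicyc_complete_arc)
      then show False using free C(2) by blast
    qed
    obtain m \<rho> where lay: "layered ?W ?E' k m \<rho>"
      using less.hyps[OF _ _ E' k freeW eqs(2)] V W l k by auto
    have part: "A \<union> B = ?W" "A \<inter> B = {}" using AB Cne by (auto simp: A_def B_def)
    have part': "?E' \<inter> B \<times> A = {}" using BA by auto
    have E_eq: "E = ?E' \<union> (C \<times> C - Id) \<union> A \<times> C \<union> C \<times> B"
    \<comment> \<open>Every outside vertex lies in \<open>A\<close> or \<open>B\<close>, and each of
      these classes allows only one direction of arcs with \<open>C\<close>.\<close>
    proof (intro equalityI subrelI)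
      fix u v assume uv: "(u, v) \<in> E"
      have "(u, v) \<in> C \<times> C - Id" if "u \<in> C" "v \<in> C" using that uv CC by blast
      moreover have "u \<in> A" if "u \<in> ?W" "v \<in> C" using AB[OF that(1)] that uv by (auto simp: B_def)
      moreover have "v \<in> B" if "u \<in> C" "v \<in> ?W" using AB[OF that(2)] that uv by (auto simp: A_def)
      moreover have "u \<in> V" "v \<in> V" using uv E(1) by auto
      ultimately show "(u, v) \<in> ?E' \<union> (C \<times> C - Id) \<union> A \<times> C \<union> C \<times> B"
        using uv by auto
    next
      fix u v assume "(u, v) \<in> ?E' \<union> (C \<times> C - Id) \<union> A \<times> C \<union> C \<times> B"
      then show "(u, v) \<in> E" unfolding CC[symmetric] by (auto simp: A_def B_def)
    qed
    have "\<exists>\<rho>'. layered (C \<union> ?W) E k (Suc m) \<rho>'"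
      using layered_insert[OF lay finite_Diff[OF V] finC Cne C(2) Diff_disjoint part part' E_eq] .
    moreover have "C \<union> ?W = V" using C(1) by auto
    ultimately show ?thesis by metis
  qed
qed

section \<open>Arc count, cycle lengths and existence of layered digraphs\<close>

text \<open>\<open>layered\<close> only says that at most one fibre has size other than
  \<open>k\<close>. The number of fibres, \<open>num_parts\<close>, then forces the size of an
  exceptional fibre to be \<open>card V mod k\<close>.\<close>

lemma layered_fibers:
  assumes lay: "layered V E k m \<rho>" and V: "finite V" and k: "k \<ge> 1"
  defines "f \<equiv> \<lambda>i. card {v \<in> V. \<rho> v = i}"
  shows "i < m \<Longrightarrow> f i \<le> k"
    and "(\<Sum>i<m. int (f i) * (int (f i) - 1)) =
      int (card V div k) * (int k * (int k - 1)) + int (card V mod k) * (int (card V mod k) - 1)"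
proof -
  let ?n = "card V"
  have im: "\<rho> ` V = {..<m}" and m: "m = num_parts ?n k" and ex: "card {i. i < m \<and> f i \<noteq> k} \<le> 1"
    using lay by (auto simp: layered_def f_def)
  have "V = (\<Union>i<m. {v \<in> V. \<rho> v = i})" using im by auto
  then have "?n = card (\<Union>i<m. {v \<in> V. \<rho> v = i})" by simp
  also have "\<dots> = (\<Sum>i<m. f i)"
    unfolding f_def using V by (intro card_UN_disjoint) auto
  finally have sum: "(\<Sum>i<m. f i) = ?n" ..
  have *: "(\<forall>i<m. f i \<le> k) \<and> (\<Sum>i<m. int (f i) * (int (f i) - 1)) =
      int (?n div k) * (int k * (int k - 1)) + int (?n mod k) * (int (?n mod k) - 1)"
  proof (cases "\<exists>j<m. f j \<noteq> k")
    case False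
    then have all: "f i = k" if "i < m" for i using that by auto
    then have "?n = m * k" using sum by simp
    then show ?thesis using all k by simp
  next
    case True
    then obtain j where j: "j < m" "f j \<noteq> k" by blast
    have all: "f i = k" if "i \<in> {..<m} - {j}" for i
    proof (rule ccontr)
      assume "f i \<noteq> k"
      then have "card {i, j} \<le> card {i. i < m \<and> f i \<noteq> k}"
        using that j by (intro card_mono) auto
      then show False using ex that by simp
    qed
    have "?n = f j + (\<Sum>i\<in>{..<m} - {j}. f i)"
      using sum.remove[of "{..<m}" j f] j sum by simp
    also have "(\<Sum>i\<in>{..<m} - {j}. f i) = (m - 1) * k"
      using all j by simp
    finally have n: "?n = f j + (m - 1) * k" .
    \<comment> \<open>If \<open>k\<close> divided \<open>card V\<close>, there would be
      \<open>card V div k\<close> fibres, and the exceptional one would also have size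
      \<open>k\<close>.\<close>
    have r: "?n mod k \<noteq> 0"
    proof
      assume "?n mod k = 0"
      moreover then have "?n = m * k" using m by (auto simp: num_parts_def)
      ultimately show False using n j by (cases m) auto
    qed
    then have q: "m = Suc (?n div k)" using m by (simp add: num_parts_def)
    then have "?n = f j + ?n div k * k" using n by (metis diff_Suc_1)
    then have fj: "f j = ?n mod k" using div_mult_mod_eq[of ?n k] by linarith
    have "(\<Sum>i<m. int (f i) * (int (f i) - 1)) = int (f j) * (int (f j) - 1)
        + (\<Sum>i\<in>{..<m} - {j}. int (f i) * (int (f i) - 1))"
      using j by (intro sum.remove) auto
    also have "(\<Sum>i\<in>{..<m} - {j}. int (f i) * (int (f i) - 1)) = (\<Sum>i\<in>{..<m} - {j}. int k * (int k - 1))"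
      using all by (intro sum.cong) auto
    also have "\<dots> = int (?n div k) * (int k * (int k - 1))" using j q by simp
    finally have "(\<Sum>i<m. int (f i) * (int (f i) - 1)) =
      int (?n div k) * (int k * (int k - 1)) + int (?n mod k) * (int (?n mod k) - 1)"
      using fj by simp
    moreover have "f i \<le> k" if "i < m" for i
      using that all[of i] fj k mod_less_divisor[of k ?n] by (cases "i = j") (auto intro: less_imp_le)
    ultimately show ?thesis by blast
  qed
  show "i < m \<Longrightarrow> f i \<le> k"
    and "(\<Sum>i<m. int (f i) * (int (f i) - 1)) =
      int (?n div k) * (int k * (int k - 1)) + int (?n mod k) * (int (?n mod k) - 1)"
    using * by auto
qed

lemma int_times_pred: "int (a * (a - 1)) = int a * (int a - 1)"
  by (cases a) (simp_all add: algebra_simps)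

text \<open>Inclusion-exclusion for \<open>E\<close> and its converse: the union consists of all
  ordered pairs of distinct vertices, the intersection of those within a fibre. These give the terms
  of \<open>twice_F_arcs\<close>.\<close>

lemma card_arcs_layered:
  assumes lay: "layered V E k m \<rho>" and V: "finite V" and k: "k \<ge> 1"
  shows "2 * int (card E) = twice_F_arcs (card V) k"
proof -
  let ?F = "\<lambda>i. {v \<in> V. \<rho> v = i}"
  have E: "E = {(u, v). u \<in> V \<and> v \<in> V \<and> u \<noteq> v \<and> \<rho> u \<le> \<rho> v}" and im: "\<rho> ` V = {..<m}"
    using lay by (auto simp: layered_def)
  have "E \<subseteq> V \<times> V" by (auto simp: E)
  then have fin: "finite E" using V by (meson finite_SigmaI finite_subset)
  have un: "E \<union> E\<inverse> = V \<times> V - Id" by (auto simp: E)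
  have inter: "E \<inter> E\<inverse> = (\<Union>i<m. ?F i \<times> ?F i - Id)" using im by (auto simp: E)
  have "2 * card E = card E + card (E\<inverse>)" by simp
  also have "\<dots> = card (E \<union> E\<inverse>) + card (E \<inter> E\<inverse>)"
    using fin by (intro card_Un_Int) auto
  also have "card (E \<union> E\<inverse>) = card V * (card V - 1)" using V by (simp add: un card_offdiag)
  also have "card (E \<inter> E\<inverse>) = (\<Sum>i<m. card (?F i \<times> ?F i - Id))"
    unfolding inter using V by (intro card_UN_disjoint) auto
  also have "\<dots> = (\<Sum>i<m. card (?F i) * (card (?F i) - 1))" using V by (simp add: card_offdiag)
  finally have "int (2 * card E) = int (card V * (card V - 1)) + (\<Sum>i<m. int (card (?F i) * (card (?F i) - 1)))"
    by (simp only: of_nat_add of_nat_sum)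
  then show ?thesis
    unfolding int_times_pred using layered_fibers(2)[OF assms] by (simp add: twice_F_arcs_def)
qed

text \<open>Ranks never decrease along arcs, so they are constant on a cycle, which therefore stays
  in one fibre.\<close>

lemma length_dicyc_layered:
  assumes lay: "layered V E k m \<rho>" and V: "finite V" and k: "k \<ge> 1" and xs: "dicyc E xs"
  shows "length xs \<le> k"
proof -
  have E: "E = {(u, v). u \<in> V \<and> v \<in> V \<and> u \<noteq> v \<and> \<rho> u \<le> \<rho> v}" and im: "\<rho> ` V = {..<m}"
    using lay by (auto simp: layered_def)
  have ne: "xs \<noteq> []" and last: "\<rho> (last xs) \<le> \<rho> (hd xs)" and d: "distinct xs"
    using xs by (auto simp: dicyc_def E)
  have "successively (\<lambda>x y. \<rho> x \<le> \<rho> y) xs"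
    using xs by (auto simp: dicyc_def E elim: successively_mono)
  then have "sorted (map \<rho> xs)"
    by (subst (asm) successively_conv_sorted_wrt) (auto simp: sorted_map intro: transpI)
  then have between: "\<rho> (hd xs) \<le> \<rho> (xs ! i) \<and> \<rho> (xs ! i) \<le> \<rho> (last xs)" if "i < length xs" for i
    using sorted_nth_mono[of "map \<rho> xs" 0 i] sorted_nth_mono[of "map \<rho> xs" i "length xs - 1"] that ne
    by (simp add: hd_conv_nth last_conv_nth)
  have sub: "set xs \<subseteq> V" using xs by (auto simp: dicyc_conv_nth E in_set_conv_nth)
  then have "set xs \<subseteq> {v \<in> V. \<rho> v = \<rho> (hd xs)}"
    using between last by (fastforce simp: in_set_conv_nth)
  then have "card (set xs) \<le> card {v \<in> V. \<rho> v = \<rho> (hd xs)}"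
    using V by (intro card_mono) auto
  also have "hd xs \<in> V" using sub ne by auto
  then have "\<rho> (hd xs) < m" using im by auto
  then have "card {v \<in> V. \<rho> v = \<rho> (hd xs)} \<le> k" by (rule layered_fibers(1)[OF lay V k])
  finally show ?thesis using d by (simp add: distinct_card)
qed

text \<open>Consecutive blocks of \<open>k\<close> numbers, with any short block last.\<close>

lemma layered_exists:
  assumes k: "k \<ge> 1"
  shows "layered {..<n} {(u, v). u < n \<and> v < n \<and> u \<noteq> v \<and> u div k \<le> v div k} k (num_parts n k) (\<lambda>v. v div k)"
proof -
  have 1: "(\<lambda>v. v div k) ` {..<n} = {..<num_parts n k}"
  proof (intro equalityI subsetI)
    fix i assume "i \<in> (\<lambda>v. v div k) ` {..<n}"
    then obtain v where v: "v < n" "i = v div k" by auto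
    have "v div k < n div k" if "n mod k = 0"
      using that v(1) k by (metis div_less_iff_less_mult less_eq_Suc_le One_nat_def mod_0_imp_dvd dvd_div_mult_self)
    moreover have "v div k \<le> n div k" using v(1) by (simp add: div_le_mono)
    ultimately show "i \<in> {..<num_parts n k}" using v(2) by (auto simp: num_parts_def)
  next
    fix i assume i: "i \<in> {..<num_parts n k}"
    \<comment> \<open>\<open>i * k\<close> is the first number of block \<open>i\<close> and
      witnesses that this block is nonempty.\<close>
    have "i * k < n"
    proof (cases "i < n div k")
      case True
      then have "Suc i * k \<le> n div k * k" by (intro mult_le_mono1) simp
      also have "\<dots> \<le> n" by simp
      finally show ?thesis using k by simp
    next
      case False
      then have "i = n div k" "n mod k \<noteq> 0" using i by (auto simp: num_parts_def split: if_splits)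
      then show ?thesis by (metis div_mult_mod_eq less_add_same_cancel1 neq0_conv)
    qed
    then show "i \<in> (\<lambda>v. v div k) ` {..<n}" using k by (auto intro!: image_eqI[of _ _ "i * k"])
  qed
  have "card {v \<in> {..<n}. v div k = i} = k" if "i < n div k" for i
  proof -
    have "Suc i * k \<le> n div k * k" using that by (intro mult_le_mono1) simp
    also have "\<dots> \<le> n" by simp
    finally have n: "Suc i * k \<le> n" .
    have eq: "v div k = i \<longleftrightarrow> i * k \<le> v \<and> v < Suc i * k" for v
      using k div_times_less_eq_dividend[of v k] dividend_less_div_times[of k v] div_nat_eqI[of k i v]
      by (auto simp: mult.commute)
    have "{v \<in> {..<n}. v div k = i} = {i * k..<Suc i * k}"
      unfolding eq using n by (intro set_eqI) (simp only: mem_Collect_eq lessThan_iff atLeastLessThan_iff, linarith)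
    then show ?thesis by simp
  qed
  then have "i = n div k" if "i < num_parts n k" "card {v \<in> {..<n}. v div k = i} \<noteq> k" for i
    using that by (cases "i < n div k") (auto simp: num_parts_def split: if_splits)
  then have "{i. i < num_parts n k \<and> card {v \<in> {..<n}. v div k = i} \<noteq> k} \<subseteq> {n div k}"
    by blast
  then have "card {i. i < num_parts n k \<and> card {v \<in> {..<n}. v div k = i} \<noteq> k} \<le> 1"
    using card_mono[of "{n div k}"] by fastforce
  with 1 show ?thesis by (simp add: layered_def)
qed

section \<open>Translation to the record-based notions\<close>

lemma complete_digraph_induce:
  assumes "finite S"
  shows "complete_digraph (card S) (induce_subgraph (with_proj D) S) \<longleftrightarrow> parcs D \<inter> S \<times> S = S \<times> S - Id"
proof -
  have "induce_subgraph (with_proj D) S = with_proj \<lparr>pverts = S, parcs = parcs D \<inter> S \<times> S\<rparr>"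
    by (auto simp: induce_subgraph_def with_proj_def)
  then show ?thesis using assms by (auto simp: complete_digraph_pair_def)
qed

text \<open>Parts are numbered from 1 and ranks from 0, so \<open>V (Suc i)\<close> is the fibre of
  rank \<open>i\<close>.\<close>

lemma F_family_iff_layered:
  "D \<in> F_family n k \<longleftrightarrow> pair_digraph D \<and> card (pverts D) = n \<and> (\<exists>m \<rho>. layered (pverts D) (parcs D) k m \<rho>)"
proof (cases "pair_digraph D \<and> card (pverts D) = n")
  case True
  then interpret pair_digraph D by simp
  let ?m = "num_parts n k"
  let ?I = "{1..?m}"
  let ?P = "\<lambda>V. partition_on (pverts D) (V ` ?I) \<and> inj_on V ?I \<and> card {i \<in> ?I. card (V i) \<noteq> k} \<le> 1 \<and>
    (\<forall>i\<in>?I. complete_digraph (card (V i)) (induce_subgraph (with_proj D) (V i))) \<and>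
    (\<forall>i\<in>?I. \<forall>j\<in>?I. i < j \<longrightarrow> maps_to D (V i) (V j))"
  have fin: "finite (pverts D)" by (rule pair_finite_verts)
  have card_shift: "card {i \<in> ?I. P i} = card {i. i < ?m \<and> P (Suc i)}" for P
  proof -
    have "{i \<in> ?I. P i} = Suc ` {i. i < ?m \<and> P (Suc i)}"
      by (auto simp: image_iff Suc_le_eq) (metis Suc_le_D Suc_le_eq)
    then show ?thesis by (simp add: card_image)
  qed
  have "(\<exists>V. ?P V) \<longleftrightarrow> (\<exists>m \<rho>. layered (pverts D) (parcs D) k m \<rho>)"
  proof
    assume "\<exists>V. ?P V"
    then obtain V where "?P V" by blast
    then have part: "partition_on (pverts D) (V ` ?I)"
      and ex: "card {i \<in> ?I. card (V i) \<noteq> k} \<le> 1"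
      and comp: "\<And>i. i \<in> ?I \<Longrightarrow> complete_digraph (card (V i)) (induce_subgraph (with_proj D) (V i))"
      and maps: "\<And>i j. i \<in> ?I \<Longrightarrow> j \<in> ?I \<Longrightarrow> i < j \<Longrightarrow> maps_to D (V i) (V j)"
      by blast+
    have un: "(\<Union>i\<in>?I. V i) = pverts D" and ne: "\<And>i. i \<in> ?I \<Longrightarrow> V i \<noteq> {}"
      using part by (auto simp: partition_on_def)
    have "\<forall>v\<in>pverts D. \<exists>i. i < ?m \<and> v \<in> V (Suc i)"
    proof
      fix v assume "v \<in> pverts D"
      then obtain i where i: "i \<in> ?I" "v \<in> V i" using un by blast
      then show "\<exists>i. i < ?m \<and> v \<in> V (Suc i)" by (intro exI[of _ "i - 1"]) auto
    qed
    then obtain \<rho> where \<rho>: "\<And>v. v \<in> pverts D \<Longrightarrow> \<rho> v < ?m \<and> v \<in> V (Suc (\<rho> v))" by metis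
    have arc: "(u, v) \<in> parcs D \<and> (v, u) \<notin> parcs D" if "u \<in> V (Suc i)" "v \<in> V (Suc j)" "i < j" "j < ?m" for u v i j
      using maps[of "Suc i" "Suc j"] that by (auto simp: maps_to_def)
    \<comment> \<open>For a vertex \<open>v\<close> in two different parts, \<open>maps_to\<close>
      would make \<open>(v, v)\<close> both an arc and a non-arc.\<close>
    have uniq: "i = j" if "v \<in> V (Suc i)" "v \<in> V (Suc j)" "i < ?m" "j < ?m" for v i j
      using arc[of v i v j] arc[of v j v i] that by (cases i j rule: linorder_cases) auto
    have sub: "V (Suc i) \<subseteq> pverts D" if "i < ?m" for i using un that by auto
    have fib: "{v \<in> pverts D. \<rho> v = i} = V (Suc i)" if "i < ?m" for i
      using \<rho> uniq sub[OF that] that by blast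
    have "\<rho> ` pverts D = {..<?m}"
    proof (intro equalityI subsetI)
      fix i assume i: "i \<in> {..<?m}"
      then have "{v \<in> pverts D. \<rho> v = i} \<noteq> {}" using ne[of "Suc i"] fib by simp
      then show "i \<in> \<rho> ` pverts D" by auto
    qed (use \<rho> in auto)
    moreover have "(u, v) \<in> parcs D \<longleftrightarrow> u \<in> pverts D \<and> v \<in> pverts D \<and> u \<noteq> v \<and> \<rho> u \<le> \<rho> v" for u v
    proof (cases "u \<in> pverts D \<and> v \<in> pverts D")
      case True
      note u = \<rho>[of u] and v = \<rho>[of v]
      consider "\<rho> u = \<rho> v" | "\<rho> u < \<rho> v" | "\<rho> v < \<rho> u" by linarith
      then show ?thesis
      proof cases
        case 1
        have "finite (V (Suc (\<rho> v)))" using fin sub True v finite_subset by metis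
        then have "parcs D \<inter> V (Suc (\<rho> v)) \<times> V (Suc (\<rho> v)) = V (Suc (\<rho> v)) \<times> V (Suc (\<rho> v)) - Id"
          using comp[of "Suc (\<rho> v)"] v True complete_digraph_induce by auto
        then show ?thesis using True u v 1 by auto
      next
        case 2
        then show ?thesis using arc[of u "\<rho> u" v "\<rho> v"] u v True by auto
      next
        case 3
        then show ?thesis using arc[of v "\<rho> v" u "\<rho> u"] u v True by auto
      qed
    qed (auto dest: in_arcsD1 in_arcsD2)
    moreover have "card {i. i < ?m \<and> card {v \<in> pverts D. \<rho> v = i} \<noteq> k} \<le> 1"
    proof -
      have "{i. i < ?m \<and> card {v \<in> pverts D. \<rho> v = i} \<noteq> k} = {i. i < ?m \<and> card (V (Suc i)) \<noteq> k}"
        by (intro Collect_cong conj_cong refl) (simp only: fib)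
      then show ?thesis using ex unfolding card_shift by simp
    qed
    ultimately have "layered (pverts D) (parcs D) k ?m \<rho>"
      using True by (auto simp: layered_def)
    then show "\<exists>m \<rho>. layered (pverts D) (parcs D) k m \<rho>" by blast
  next
    assume "\<exists>m \<rho>. layered (pverts D) (parcs D) k m \<rho>"
    then obtain \<rho> where im: "\<rho> ` pverts D = {..<?m}"
      and E: "parcs D = {(u, v). u \<in> pverts D \<and> v \<in> pverts D \<and> u \<noteq> v \<and> \<rho> u \<le> \<rho> v}"
      and ex: "card {i. i < ?m \<and> card {v \<in> pverts D. \<rho> v = i} \<noteq> k} \<le> 1"
      using True by (auto simp: layered_def)
    define V where "V i = {v \<in> pverts D. \<rho> v = i - 1}" for i
    have ne: "V i \<noteq> {}" if "i \<in> ?I" for i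
    proof -
      have "i - 1 \<in> \<rho> ` pverts D" using that im by auto
      then show ?thesis by (auto simp: V_def)
    qed
    have disj: "V i \<inter> V j = {}" if "i \<in> ?I" "j \<in> ?I" "i \<noteq> j" for i j
      using that by (auto simp: V_def)
    have "v \<in> (\<Union>i\<in>?I. V i)" if "v \<in> pverts D" for v
    proof -
      have "\<rho> v < ?m" using im that by auto
      then show ?thesis using that by (auto simp: V_def intro!: bexI[of _ "Suc (\<rho> v)"])
    qed
    then have "(\<Union>i\<in>?I. V i) = pverts D" by (auto simp: V_def)
    then have "partition_on (pverts D) (V ` ?I)"
    proof (rule partition_onI)
      show "disjnt p q" if "p \<in> V ` ?I" "q \<in> V ` ?I" "p \<noteq> q" for p q
        using that disj unfolding disjnt_def by (elim imageE) metis
      show "{} \<notin> V ` ?I" using ne by (metis imageE)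
    qed
    moreover have "inj_on V ?I" using ne disj by (metis inj_onI inf.idem)
    moreover have "card {i \<in> ?I. card (V i) \<noteq> k} \<le> 1" using ex unfolding card_shift by (simp add: V_def)
    moreover have "complete_digraph (card (V i)) (induce_subgraph (with_proj D) (V i))" for i
      by (subst complete_digraph_induce) (auto simp: V_def E fin)
    moreover have "maps_to D (V i) (V j)" if "i \<in> ?I" "j \<in> ?I" "i < j" for i j
      using that by (auto simp: maps_to_def V_def E)
    ultimately show "\<exists>V. ?P V" by blast
  qed
  then show ?thesis using True by (simp add: F_family_def Let_def)
qed (auto simp: F_family_def)

text \<open>A copy of \<open>dicycle m\<close> is the same as an injective map from
  \<open>{..<m}\<close> that preserves the cyclic arcs; the list enumerates its values.\<close>

lemma free_of_dicycle_iff: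
  assumes "pair_digraph D" "m \<ge> 1"
  shows "free_of (dicycle m) D \<longleftrightarrow> (\<forall>xs. dicyc (parcs D) xs \<longrightarrow> length xs \<noteq> m)"
proof -
  interpret pair_digraph D by fact
  let ?H = "with_proj (dicycle m)"
  have "(\<exists>S. subgraph S (with_proj D) \<and> digraph_iso S ?H) \<longleftrightarrow> (\<exists>xs. dicyc (parcs D) xs \<and> length xs = m)"
  proof
    assume "\<exists>S. subgraph S (with_proj D) \<and> digraph_iso S ?H"
    then obtain S h where S: "subgraph S (with_proj D)" and h: "pre_digraph.digraph_isomorphism S h"
      and H: "?H = app_iso h S"
      by (auto simp: digraph_iso_def)
    have arcsS: "arcs S \<subseteq> parcs D" "tail S = fst" "head S = snd" "wf_digraph S"
      using S by (auto simp: subgraph_def compatible_def)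
    have inj: "inj_on (iso_verts h) (verts S)"
      and ends: "\<And>a. a \<in> arcs S \<Longrightarrow> iso_verts h (fst a) = iso_tail h (iso_arcs h a)
        \<and> iso_verts h (snd a) = iso_head h (iso_arcs h a)"
      using h arcsS unfolding pre_digraph.digraph_isomorphism_def by auto
    have verts: "iso_verts h ` verts S = {..<m}" and arcs: "iso_arcs h ` arcs S = parcs (dicycle m)"
      and proj: "iso_tail h = fst" "iso_head h = snd"
      using arg_cong[OF H, of verts] arg_cong[OF H, of arcs] arg_cong[OF H, of tail] arg_cong[OF H, of head]
      by (simp_all add: dicycle_def)
    \<comment> \<open>The isomorphism leads from \<open>S\<close> to the standard cycle; its inverse
      lists the vertices of \<open>S\<close> in cyclic order.\<close>
    define g where "g = the_inv_into (verts S) (iso_verts h)"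
    have g: "g (iso_verts h v) = v" if "v \<in> verts S" for v
      unfolding g_def using inj that by (rule the_inv_into_f_f)
    have arcg: "(g i, g (Suc i mod m)) \<in> parcs D" if "i < m" for i
    proof -
      have "(i, Suc i mod m) \<in> parcs (dicycle m)" using that by (auto simp: dicycle_def)
      then obtain a where a: "a \<in> arcs S" "iso_arcs h a = (i, Suc i mod m)"
        using arcs by (metis imageE)
      then have "iso_verts h (fst a) = i" "iso_verts h (snd a) = Suc i mod m"
        using ends[OF a(1)] proj by auto
      moreover have "fst a \<in> verts S" "snd a \<in> verts S"
        using wf_digraph.wellformed[OF arcsS(4) a(1)] arcsS by auto
      ultimately have "a = (g i, g (Suc i mod m))" using g by (metis prod.collapse)
      then show ?thesis using a arcsS by auto
    qed
    have "inj_on g {..<m}"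
      unfolding verts[symmetric] g_def using inj by (rule inj_on_the_inv_into)
    then have "dicyc (parcs D) (map g [0..<m])"
      using arcg assms(2) by (auto simp: dicyc_conv_nth distinct_map lessThan_atLeast0)
    then show "\<exists>xs. dicyc (parcs D) xs \<and> length xs = m"
      by (intro exI[of _ "map g [0..<m]"]) simp
  next
    assume "\<exists>xs. dicyc (parcs D) xs \<and> length xs = m"
    then obtain xs where xs: "xs \<noteq> []" "distinct xs" "length xs = m"
      and arc: "\<And>i. i < m \<Longrightarrow> (xs ! i, xs ! (Suc i mod m)) \<in> parcs D"
      by (auto simp: dicyc_conv_nth)
    let ?\<phi> = "\<lambda>i. xs ! i"
    \<comment> \<open>Relabels position \<open>i\<close> as \<open>xs ! i\<close>; the image of the
      standard cycle under \<open>h\<close> is the required subdigraph.\<close>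
    define h where "h = \<lparr>iso_verts = ?\<phi>, iso_arcs = map_prod ?\<phi> ?\<phi>, iso_head = snd, iso_tail = fst\<rparr>"
    have m: "m > 0" using assms by simp
    have inj: "inj_on ?\<phi> {..<m}" using xs by (auto simp: inj_on_nth)
    interpret H: wf_digraph ?H
      using m by unfold_locales (auto simp: dicycle_def)
    have sub: "parcs (dicycle m) \<subseteq> {..<m} \<times> {..<m}" using m by (auto simp: dicycle_def)
    have hom: "H.digraph_isomorphism h"
      unfolding H.digraph_isomorphism_def
    proof (intro conjI)
      show "wf_digraph ?H" ..
      show "inj_on (iso_verts h) (verts ?H)" using inj by (simp add: h_def dicycle_def)
      show "inj_on (iso_arcs h) (arcs ?H)"
        using inj_on_subset[OF map_prod_inj_on[OF inj inj] sub] by (simp add: h_def)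
    qed (simp add: h_def)
    define S where "S = app_iso h ?H"
    have "digraph_iso S ?H"
      using H.digraph_isomorphism_invI[OF hom] H.app_iso_inv[OF hom]
      unfolding digraph_iso_def S_def by metis
    moreover have "subgraph S (with_proj D)"
      unfolding subgraph_def
    proof (intro conjI)
      have "xs ! i \<in> pverts D" if "i < m" for i using arc[OF that] wellformed' by blast
      then show "verts S \<subseteq> verts (with_proj D)" by (auto simp: S_def h_def dicycle_def)
      show "arcs S \<subseteq> arcs (with_proj D)" using arc by (auto simp: S_def h_def dicycle_def)
      show "wf_digraph S" unfolding S_def using hom by (rule H.wf_digraphI_app_iso)
      show "wf_digraph (with_proj D)" ..
      show "compatible (with_proj D) S" by (simp add: compatible_def S_def h_def)
    qed
    ultimately show "\<exists>S. subgraph S (with_proj D) \<and> digraph_iso S ?H" by blast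
  qed
  then show ?thesis by (auto simp: free_of_def)
qed

section \<open>The extremal number and the extremal family\<close>

theorem theorem1p8:
  fixes n k q r :: nat
  assumes "k \<ge> 1" and "n \<ge> 1" and "n = q * k + r" and "r < k"
  shows "F_family n k \<noteq> {} \<and>
    (\<forall>F \<in> F_family n k.
       ex_number n (dicycle (k + 1)) = num_arcs F \<and>
       real (num_arcs F) =
         1 / 2 * (real n)\<^sup>2 + (real k - 2) / 2 * real n - real r * (real k - real r) / 2) \<and>
    (k \<ge> 3 \<longrightarrow> EX_family n (dicycle (k + 1)) = F_family n k)"
proof -
  let ?H = "dicycle (Suc k)"
  have irrefl: "irrefl (parcs D)" and fin: "finite (pverts D)" and sub: "parcs D \<subseteq> pverts D \<times> pverts D"
    if "pair_digraph D" for D :: "nat pair_pre_digraph"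
  proof -
    interpret pair_digraph D by fact
    show "irrefl (parcs D)" using pair_no_loops by (fastforce simp: irrefl_def)
    show "finite (pverts D)" by (rule pair_finite_verts)
    show "parcs D \<subseteq> pverts D \<times> pverts D" using wellformed' by auto
  qed
  have free: "D \<in> free_digraphs n ?H \<longleftrightarrow> pair_digraph D \<and> card (pverts D) = n
      \<and> (\<forall>xs. dicyc (parcs D) xs \<longrightarrow> length xs \<noteq> Suc k)" for D
    by (auto simp: free_digraphs_def free_of_dicycle_iff)
  have upper: "2 * int (num_arcs D) \<le> twice_F_arcs n k" if "D \<in> free_digraphs n ?H" for D
    using that card_arcs_le[of "pverts D" "parcs D" k] fin sub irrefl assms(1) by (auto simp: free)
  have F: "F \<in> free_digraphs n ?H" "2 * int (num_arcs F) = twice_F_arcs n k" if FF: "F \<in> F_family n k" for F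
  proof -
    obtain m \<rho> where F: "pair_digraph F" "card (pverts F) = n" and lay: "layered (pverts F) (parcs F) k m \<rho>"
      using FF by (auto simp: F_family_iff_layered)
    have "length xs \<noteq> Suc k" if "dicyc (parcs F) xs" for xs
      using length_dicyc_layered[OF lay fin[OF F(1)] assms(1) that] by simp
    then show "F \<in> free_digraphs n ?H" using F by (simp add: free)
    show "2 * int (num_arcs F) = twice_F_arcs n k"
      using card_arcs_layered[OF lay fin[OF F(1)] assms(1)] F by simp
  qed
  have ex: "ex_number n ?H = num_arcs F" if "F \<in> F_family n k" for F
    unfolding ex_number_def
  proof (rule Max_eqI)
    have "num_arcs D \<le> num_arcs F" if "D \<in> free_digraphs n ?H" for D
      using upper[OF that] F[OF \<open>F \<in> F_family n k\<close>] by simp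
    then show "y \<le> num_arcs F" if "y \<in> num_arcs ` free_digraphs n ?H" for y using that by auto
    \<comment> \<open>There may be infinitely many digraphs over the naturals, but their arc counts
      are bounded by \<open>num_arcs F\<close>.\<close>
    then show "finite (num_arcs ` free_digraphs n ?H)" by (rule finite_nat_set_iff_bounded_le[THEN iffD2, OF exI, OF ballI])
    show "num_arcs F \<in> num_arcs ` free_digraphs n ?H" using F(1)[OF that] by blast
  qed
  have formula: "real (num_arcs F) =
      1 / 2 * (real n)\<^sup>2 + (real k - 2) / 2 * real n - real r * (real k - real r) / 2"
    if "F \<in> F_family n k" for F
  proof -
    have "n div k = q" "n mod k = r" using assms by auto
    then have "2 * int (num_arcs F) = int n * (int n - 1) + int q * (int k * (int k - 1)) + int r * (int r - 1)"
      using F(2)[OF that] by (simp add: twice_F_arcs_def)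
    then have "real_of_int (2 * int (num_arcs F)) =
        real_of_int (int n * (int n - 1) + int q * (int k * (int k - 1)) + int r * (int r - 1))"
      \<comment> \<open>The integer identity moves to the reals, where the halves of the formula
        live; with \<open>n = q * k + r\<close> substituted, it becomes a polynomial
        identity.\<close>
      by (rule arg_cong)
    then show ?thesis unfolding assms(3) by (simp add: field_simps power2_eq_square)
  qed
  obtain F0 where F0: "F0 \<in> F_family n k"
  proof
    \<comment> \<open>The block digraph shows that the family is nonempty and later supplies the
      value of \<open>ex_number\<close>.\<close>
    let ?D = "\<lparr>pverts = {..<n}, parcs = {(u, v). u < n \<and> v < n \<and> u \<noteq> v \<and> u div k \<le> v div k}\<rparr>"
    have "parcs ?D \<subseteq> {..<n} \<times> {..<n}" by auto
    then have "finite (parcs ?D)" by (rule finite_subset) simp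
    then have "pair_digraph ?D" by unfold_locales auto
    then show "?D \<in> F_family n k"
      using layered_exists[OF assms(1), of n] by (auto simp: F_family_iff_layered)
  qed
  have "EX_family n ?H = F_family n k" if k: "k \<ge> 3"
  proof (intro equalityI subsetI)
    fix D assume "D \<in> EX_family n ?H"
    then have D: "D \<in> free_digraphs n ?H" "2 * int (num_arcs D) = twice_F_arcs n k"
      using ex[OF F0] F(2)[OF F0] by (auto simp: EX_family_def)
    then have "\<exists>m \<rho>. layered (pverts D) (parcs D) k m \<rho>"
      using fin sub irrefl k by (intro layered_if_card_arcs_max) (auto simp: free)
    then show "D \<in> F_family n k" using D by (auto simp: free F_family_iff_layered)
  qed (use F ex in \<open>auto simp: EX_family_def\<close>)
  moreover have "F_family n k \<noteq> {}" using F0 by blast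
  ultimately show ?thesis by (simp add: ex formula)
qed

end
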